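(* Let $d$ be a positive integer, let $(X_{\mathbf{n}})_{\mathbf{n}\in\mathbb{N}^d}$ be a field of real random variables on a probability space $(\Omega,\mathcal{F},\mathbb{P})$ with partial sums $(S_{\mathbf{n}})_{\mathbf{n}\in\mathbb{N}^d}$, let $(a_{\mathbf{n}})_{\mathbf{n}\in\mathbb{N}^d}$ be a family of nonnegative real numbers and let $r>0$. Suppose that $(b_{\mathbf{n}})_{\mathbf{n}\in\mathbb{N}^d}$ is a positive, nondecreasing, unbounded $d$-sequence of product type. If $$\sum_{\mathbf{n}\in\mathbb{N}^d}\frac{a_{\mathbf{n}}}{b_{\mathbf{n}}^{r}}<+\infty$$ and there exists $C>0$ such that for every $\mathbf{n}\in\mathbb{N}^d$ and every $\varepsilon>0$ $$\mathbb{P}\Big(\max_{\mathbf{m}\le\mathbf{n}}|S_{\mathbf{m}}|\ge\varepsilon\Big)\le C\,\varepsilon^{-r}\sum_{\mathbf{m}\le\mathbf{n}}a_{\mathbf{m}},$$ then $$\lim_{\mathbf{n}\to\infty}\frac{S_{\mathbf{n}}}{b_{\mathbf{n}}}=0\quad\text{almost surely.}$$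
   Context: $\mathbb{N}$ is the set of nonnegative integers. $\mathbb{N}^d$ carries the coordinatewise partial order: $\mathbf{m}\le\mathbf{n}$ iff $m_i\le n_i$ for all $1\le i\le d$; $\mathbf{m}<\mathbf{n}$ means $\mathbf{m}\le\mathbf{n}$ and $\mathbf{m}\ne\mathbf{n}$; $\mathbf{0}=(0,\dots,0)$. The partial sums are $S_{\mathbf{0}}=0$ and $S_{\mathbf{n}}=\sum_{\mathbf{m}\le\mathbf{n}}X_{\mathbf{m}}$ for $\mathbf{n}>\mathbf{0}$. The limit $\mathbf{n}\to\infty$ means $n_i\to+\infty$ for each $1\le i\le d$ (that is, $\min_i n_i\to\infty$). A $d$-sequence is a family of real numbers indexed by $\mathbb{N}^d$. A $d$-sequence $(b_{\mathbf{n}})$ is positive, nondecreasing, unbounded, of product type if $b_{\mathbf{n}}=\prod_{i=1}^d b^{(i)}_{n_i}$ for all $\mathbf{n}=(n_1,\dots,n_d)$, where for each $i$ the sequence $(b^{(i)}_{k})_{k\ge0}$ is a nondecreasing and unbounded sequence of positive real numbers. *)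

theory Defs
  imports "HOL-Probability.Probability"
begin

text \<open>
  The index set \<open>\<nat>\<^sup>d\<close> is the type \<open>nat ^ 'd\<close> with \<open>d = CARD('d) \<ge> 1\<close>; its library order is the
  coordinatewise one.  The origin is special: the partial sum there is \<open>0\<close>, whereas
  the term with index \<open>0\<close> does contribute to every other partial sum.
\<close>

definition partial_sum :: "(nat ^ 'd \<Rightarrow> 'w \<Rightarrow> real) \<Rightarrow> nat ^ 'd \<Rightarrow> 'w \<Rightarrow> real" where
  "partial_sum X n \<omega> = (if n = 0 then 0 else (\<Sum>m | m \<le> n. X m \<omega>))"

definition pos_nondecr_unbounded_product_type :: "(nat ^ 'd \<Rightarrow> real) \<Rightarrow> bool" where
  "pos_nondecr_unbounded_product_type b \<longleftrightarrow>
    (\<exists>\<beta> :: 'd \<Rightarrow> nat \<Rightarrow> real.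
      (\<forall>i. (\<forall>k. \<beta> i k > 0) \<and> mono (\<beta> i) \<and> \<not> bdd_above (range (\<beta> i))) \<and>
      (\<forall>n. b n = (\<Prod>i\<in>UNIV. \<beta> i (n $ i))))"

text \<open>
  Sums and maxima over \<open>{m. m \<le> n}\<close> are not degenerate, because these sets are finite.
\<close>

lemma finite_atMost_vec: "finite {m :: nat ^ 'd. m \<le> n}"
proof -
  have "{m :: nat ^ 'd. m \<le> n} \<subseteq> vec_lambda ` (\<Pi>\<^sub>E i\<in>UNIV. {..n $ i})"
  proof
    fix m :: "nat ^ 'd" assume "m \<in> {m. m \<le> n}"
    then have "vec_nth m \<in> (\<Pi>\<^sub>E i\<in>UNIV. {..n $ i})"
      by (auto simp: less_eq_vec_def)
    then have "vec_lambda (vec_nth m) \<in> vec_lambda ` (\<Pi>\<^sub>E i\<in>UNIV. {..n $ i})"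
      by (rule imageI)
    then show "m \<in> vec_lambda ` (\<Pi>\<^sub>E i\<in>UNIV. {..n $ i})" by simp
  qed
  then show ?thesis
    by (rule finite_subset) (intro finite_imageI finite_PiE, auto)
qed

text \<open>
  The filter \<open>at_top\<close> of the coordinatewise order is convergence of all coordinates to infinity.
\<close>

lemma eventually_at_top_vec:
  "eventually P (at_top :: (nat ^ 'd) filter) \<longleftrightarrow> (\<exists>N. \<forall>n. (\<forall>i. N \<le> n $ i) \<longrightarrow> P n)"
proof -
  have "eventually P (at_top :: (nat ^ 'd) filter) \<longleftrightarrow> (\<exists>k. \<forall>n\<ge>k. P n)"
    unfolding at_top_def
  proof (subst eventually_INF_base)
    fix k l :: "nat ^ 'd"
    show "\<exists>x\<in>UNIV. principal {x..} \<le> inf (principal {k..}) (principal {l..})"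
      by (rule bexI[of _ "\<chi> i. max (k $ i) (l $ i)"]) (auto simp: less_eq_vec_def)
  qed (auto simp: eventually_principal)
  also have "\<dots> \<longleftrightarrow> (\<exists>N. \<forall>n. (\<forall>i. N \<le> n $ i) \<longrightarrow> P n)"
  proof
    assume "\<exists>k. \<forall>n\<ge>k. P n"
    then obtain k where k: "\<And>n. k \<le> n \<Longrightarrow> P n" by blast
    have "P n" if "\<forall>i. Max (range (vec_nth k)) \<le> n $ i" for n
    proof (rule k)
      have "k $ i \<le> Max (range (vec_nth k))" for i by (rule Max_ge) auto
      then show "k \<le> n" using that by (auto simp: less_eq_vec_def intro: order_trans)
    qed
    then show "\<exists>N. \<forall>n. (\<forall>i. N \<le> n $ i) \<longrightarrow> P n" by blast
  next
    assume "\<exists>N. \<forall>n. (\<forall>i. N \<le> n $ i) \<longrightarrow> P n"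
    then obtain N where "\<And>n. (\<forall>i. N \<le> n $ i) \<Longrightarrow> P n" by blast
    then show "\<exists>k. \<forall>n\<ge>k. P n"
      by (intro exI[of _ "\<chi> i. N"]) (auto simp: less_eq_vec_def)
  qed
  finally show ?thesis .
qed

end

theory Submission
  imports Defs
begin

text \<open>
  Split \<open>\<nat>\<^sup>d\<close> into blocks indexed by \<open>k \<in> \<nat>\<^sup>d\<close>, on which every factor \<open>\<beta> i\<close> of \<open>b\<close> stays within the
  dyadic range from \<open>\<beta> i 0 * 2 ^ k i\<close> to \<open>\<beta> i 0 * 2 ^ (k i + 1)\<close>.  On the block \<open>k\<close> the quotient
  \<open>\<bar>S n\<bar> / b n\<close> is at most the maximum of \<open>\<bar>S\<bar>\<close> up to the last corner of the block, divided by
  \<open>b 0 * 2 ^ (\<Sum>i. k i)\<close>.  The maximal inequality bounds the probability that this is at least \<open>\<epsilon>\<close>.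
  After exchanging the order of summation, the sum of these bounds over \<open>k\<close> is a product of \<open>d\<close>
  geometric tails for each \<open>m\<close>, and so is dominated by \<open>\<Sum>m. a m / b m powr r\<close>.  Borel--Cantelli
  leaves finitely many exceptional blocks, which are avoided once all coordinates of \<open>n\<close> are large.
\<close>

text \<open>Normalising by \<open>\<beta> 0\<close> puts index 0 at level 0, so the indices of level
  at most \<open>k\<close> always form a nonempty set.\<close>

definition dyadic_level :: "(nat \<Rightarrow> real) \<Rightarrow> nat \<Rightarrow> nat" where
  "dyadic_level \<beta> m = nat \<lfloor>log 2 (\<beta> m / \<beta> 0)\<rfloor>"

lemma dyadic_level_0: "\<beta> 0 > 0 \<Longrightarrow> dyadic_level \<beta> 0 = 0"
  by (simp add: dyadic_level_def)

lemma
  assumes "mono \<beta>" and "\<beta> 0 > 0"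
  shows dyadic_level_lower: "\<beta> 0 * 2 ^ dyadic_level \<beta> m \<le> \<beta> m"
    and dyadic_level_upper: "\<beta> m < \<beta> 0 * 2 ^ Suc (dyadic_level \<beta> m)"
proof -
  let ?x = "\<beta> m / \<beta> 0" and ?l = "dyadic_level \<beta> m"
  have ge1: "1 \<le> ?x"
    using monoD[OF assms(1), of 0 m] assms(2) by simp
  \<comment> \<open>Nonnegativity of the logarithm ensures that \<open>nat\<close> truncates
    nothing.\<close>
  then have "0 \<le> log 2 ?x" by simp
  then have l: "real ?l \<le> log 2 ?x" "log 2 ?x < real (Suc ?l)"
    by (simp_all add: dyadic_level_def) linarith+
  have "2 powr real ?l \<le> ?x" "?x < 2 powr real (Suc ?l)"
    using l ge1 by (simp_all only: le_log_iff log_less_iff)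
  then have "2 ^ ?l \<le> ?x" "?x < 2 ^ Suc ?l"
    by (simp_all only: powr_realpow zero_less_numeral)
  then show "\<beta> 0 * 2 ^ ?l \<le> \<beta> m" "\<beta> m < \<beta> 0 * 2 ^ Suc ?l"
    using assms(2) by (simp_all add: field_simps)
qed

text \<open>Once \<beta> has passed \<open>\<beta> 0 * 2 ^ Suc k\<close>, monotonicity and the upper
  dyadic bound force a level above \<open>k\<close>.\<close>

lemma finite_dyadic_level_le:
  assumes "mono \<beta>" and "\<beta> 0 > 0" and "\<not> bdd_above (range \<beta>)"
  shows "finite {m. dyadic_level \<beta> m \<le> k}"
proof -
  obtain M where M: "\<beta> M > \<beta> 0 * 2 ^ Suc k"
    using assms(3) unfolding bdd_above_def by (auto simp: not_le)
  have "m < M" if "dyadic_level \<beta> m \<le> k" for m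
  proof (rule ccontr)
    assume "\<not> m < M"
    then have "\<beta> M \<le> \<beta> m" using assms(1) by (simp add: monoD)
    also have "\<dots> < \<beta> 0 * 2 ^ Suc (dyadic_level \<beta> m)"
      using assms by (intro dyadic_level_upper)
    also have "\<dots> \<le> \<beta> 0 * 2 ^ Suc k"
      using that assms(2) by (intro mult_left_mono power_increasing) auto
    finally show False using M by simp
  qed
  then have "{m. dyadic_level \<beta> m \<le> k} \<subseteq> {..<M}" by auto
  then show ?thesis by (rule finite_subset) simp
qed

lemma dyadic_level_mono:
  assumes "mono \<beta>" and "\<beta> 0 > 0" and "m \<le> n"
  shows "dyadic_level \<beta> m \<le> dyadic_level \<beta> n"
proof -
  have "0 < \<beta> m / \<beta> 0" using monoD[OF assms(1), of 0 m] assms(2) by simp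
  moreover have "\<beta> m / \<beta> 0 \<le> \<beta> n / \<beta> 0"
    using monoD[OF assms(1,3)] assms(2) by (simp add: divide_right_mono)
  ultimately have "log 2 (\<beta> m / \<beta> 0) \<le> log 2 (\<beta> n / \<beta> 0)"
    by (intro log_mono) auto
  then show ?thesis unfolding dyadic_level_def by (intro nat_mono floor_mono)
qed

text \<open>Levels are monotone, so the indices of level at most \<open>k\<close> form a finite
  initial segment. A bound on the level thus becomes an order relation, as the maximal inequality
  requires.\<close>

lemma dyadic_level_le_iff:
  assumes "mono \<beta>" and "\<beta> 0 > 0" and "\<not> bdd_above (range \<beta>)"
  shows "m \<le> Max {m. dyadic_level \<beta> m \<le> k} \<longleftrightarrow> dyadic_level \<beta> m \<le> k"
proof
  have "0 \<in> {m. dyadic_level \<beta> m \<le> k}"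
    using assms(2) by (simp add: dyadic_level_0)
  then have "Max {m. dyadic_level \<beta> m \<le> k} \<in> {m. dyadic_level \<beta> m \<le> k}"
    by (intro Max_in finite_dyadic_level_le assms) auto
  moreover assume "m \<le> Max {m. dyadic_level \<beta> m \<le> k}"
  ultimately show "dyadic_level \<beta> m \<le> k"
    using dyadic_level_mono[OF assms(1,2)] by (auto intro: order_trans)
next
  assume "dyadic_level \<beta> m \<le> k"
  then show "m \<le> Max {m. dyadic_level \<beta> m \<le> k}"
    using finite_dyadic_level_le[OF assms] by (intro Max_ge) auto
qed

lemma dyadic_level_eventually_gt:
  assumes "mono \<beta>" and "\<beta> 0 > 0" and "\<not> bdd_above (range \<beta>)"
  shows "\<exists>N. \<forall>n\<ge>N. k < dyadic_level \<beta> n"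
  using dyadic_level_le_iff[OF assms]
  by (intro exI[of _ "Suc (Max {m. dyadic_level \<beta> m \<le> k})"]) (metis not_less Suc_le_eq)

text \<open>The exponent \<open>- r\<close> reverses the upper dyadic bound; the factor 2 is the
  price of rounding to a power of 2.\<close>

lemma dyadic_weight_le:
  fixes r :: real
  assumes "mono \<beta>" and "\<beta> 0 > 0" and "r > 0"
  shows "(2 powr (- r)) ^ dyadic_level \<beta> m \<le> (2 * \<beta> 0) powr r * \<beta> m powr (- r)"
proof -
  let ?l = "dyadic_level \<beta> m"
  have pos: "0 < \<beta> m" using monoD[OF assms(1), of 0 m] assms(2) by simp
  have "\<beta> m / (2 * \<beta> 0) \<le> 2 ^ ?l"
    using dyadic_level_upper[OF assms(1,2), of m] assms(2) by (simp add: field_simps)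
  then have "(2 ^ ?l) powr (- r) \<le> (\<beta> m / (2 * \<beta> 0)) powr (- r)"
    using pos assms(2,3) by (intro powr_mono2') auto
  also have "\<dots> = (2 * \<beta> 0) powr r * \<beta> m powr (- r)"
    using pos assms(2) by (simp add: powr_divide powr_minus field_simps)
  also have "(2 ^ ?l) powr (- r) = (2 powr (- r)) ^ ?l"
    by (simp add: powr_power powr_powr mult.commute flip: powr_realpow)
  finally show ?thesis .
qed

text \<open>The cutoff sits inside the summand so that the range of \<open>j\<close> does not depend
  on \<open>l\<close>, as \<open>sum_prod_le_prod_bound\<close> expects.\<close>

lemma geometric_tail_le:
  fixes q :: real
  assumes "0 < q" and "q < 1"
  shows "(\<Sum>j\<le>K. if l \<le> j then q ^ j else 0) \<le> q ^ l / (1 - q)"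
proof -
  have "(\<Sum>j\<le>K. if l \<le> j then q ^ j else 0) = (\<Sum>j\<in>{l..K}. q ^ j)"
    by (intro sum.mono_neutral_cong_right) auto
  also have "\<dots> \<le> q ^ l / (1 - q)"
    using assms by (auto simp: sum_gp intro!: divide_right_mono)
  finally show ?thesis .
qed

text \<open>Enlarge \<open>F\<close> to a cube: the added terms are nonnegative, and over a cube the
  sum of products factorises.\<close>

lemma sum_prod_le_prod_bound:
  fixes h :: "'d::finite \<Rightarrow> nat \<Rightarrow> real"
  assumes "finite F" and "\<And>i j. 0 \<le> h i j" and "\<And>i K. (\<Sum>j\<le>K. h i j) \<le> c i"
  shows "(\<Sum>k\<in>F. \<Prod>i\<in>UNIV. h i (k i)) \<le> (\<Prod>i\<in>UNIV. c i)"
proof -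
  define K where "K = Max (\<Union>k\<in>F. range k)"
  have "k i \<le> K" if "k \<in> F" for k i
    unfolding K_def using that assms(1) by (intro Max_ge) auto
  then have "F \<subseteq> (\<Pi>\<^sub>E i\<in>UNIV. {..K})" by auto
  then have "(\<Sum>k\<in>F. \<Prod>i\<in>UNIV. h i (k i)) \<le> (\<Sum>k\<in>(\<Pi>\<^sub>E i\<in>UNIV. {..K}). \<Prod>i\<in>UNIV. h i (k i))"
    by (intro sum_mono2 finite_PiE prod_nonneg) (auto intro: assms)
  also have "\<dots> = (\<Prod>i\<in>UNIV. \<Sum>j\<le>K. h i j)"
    by (rule prod_sum_PiE[symmetric]) auto
  also have "\<dots> \<le> (\<Prod>i\<in>UNIV. c i)"
    by (intro prod_mono) (auto intro: assms sum_nonneg)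
  finally show ?thesis .
qed

text \<open>The encoding \<open>to_nat\<close> transfers the claim to sequences of events; the
  uniform bound on finite sums gives summability there.\<close>

lemma (in prob_space) borel_cantelli_countable:
  fixes A :: "'k::countable \<Rightarrow> 'a set"
  assumes meas: "\<And>k. A k \<in> events"
    and bound: "\<And>F. finite F \<Longrightarrow> (\<Sum>k\<in>F. prob (A k)) \<le> B"
  shows "AE \<omega> in M. finite {k. \<omega> \<in> A k}"
proof -
  \<comment> \<open>As \<open>to_nat\<close> is injective but perhaps not surjective,
    \<open>E j\<close> is either a single \<open>A k\<close> or empty.\<close>
  define E where "E j = (\<Union>k\<in>{k. to_nat k = j}. A k)" for j
  have E_to_nat: "E (to_nat k) = A k" for k by (auto simp: E_def)
  have E_meas: "E j \<in> events" for j
    unfolding E_def by (intro sets.countable_UN'') (auto intro: meas)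
  have "(\<Sum>j<n. norm (prob (E j))) \<le> B" for n
  proof -
    have "(\<Sum>j<n. norm (prob (E j))) = (\<Sum>j\<in>{..<n} \<inter> range (to_nat :: 'k \<Rightarrow> nat). prob (E j))"
      proof (intro sum.mono_neutral_cong_right ballI)
      fix j assume "j \<in> {..<n} - {..<n} \<inter> range (to_nat :: 'k \<Rightarrow> nat)"
      then have "{k :: 'k. to_nat k = j} = {}" by auto
      then show "norm (prob (E j)) = 0" by (simp add: E_def)
    qed auto
    also have "{..<n} \<inter> range (to_nat :: 'k \<Rightarrow> nat) = to_nat ` {k :: 'k. to_nat k < n}" by auto
    also have "(\<Sum>j\<in>\<dots>. prob (E j)) = (\<Sum>k\<in>{k :: 'k. to_nat k < n}. prob (A k))"
      by (subst sum.reindex) (auto simp: E_to_nat inj_on_def)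
    also have "\<dots> \<le> B"
      using finite_vimageI[of "{..<n}" "to_nat :: 'k \<Rightarrow> nat"]
      by (intro bound) (simp add: vimage_def)
    finally show ?thesis .
  qed
  then have "summable (\<lambda>j. prob (E j))"
    by (intro summable_norm_cancel[OF bounded_imp_summable[of _ B]])
      (simp_all only: lessThan_Suc_atMost[symmetric] norm_ge_zero)
  then have "AE \<omega> in M. eventually (\<lambda>j. \<omega> \<in> space M - E j) sequentially"
    by (intro borel_cantelli_AE1 E_meas) (auto simp: emeasure_eq_measure)
  then show ?thesis
  proof (eventually_elim)
    case (elim \<omega>)
    then obtain N where "\<And>j. N \<le> j \<Longrightarrow> \<omega> \<notin> E j"
      by (auto simp: eventually_sequentially)
    then have "{k. \<omega> \<in> A k} \<subseteq> to_nat -` {..<N}"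
      by (auto simp: E_to_nat[symmetric] not_le[symmetric])
    then show ?case
      by (rule finite_subset) (auto intro: finite_vimageI)
  qed
qed

lemma (in prob_space) Max_ge_event:
  fixes f :: "'i \<Rightarrow> 'a \<Rightarrow> real"
  assumes "finite I" and "I \<noteq> {}" and [measurable]: "\<And>i. f i \<in> borel_measurable M"
  shows "{\<omega> \<in> space M. Max ((\<lambda>i. f i \<omega>) ` I) \<ge> c} \<in> events"
proof -
  have "{\<omega> \<in> space M. Max ((\<lambda>i. f i \<omega>) ` I) \<ge> c} = (\<Union>i\<in>I. {\<omega> \<in> space M. f i \<omega> \<ge> c})"
    using assms(1,2) by (auto simp: Max_ge_iff)
  then show ?thesis using assms(1) by auto
qed

text \<open>The bound does not depend on \<open>F\<close>, which is the form needed for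
  Borel--Cantelli over the countable set of blocks.\<close>

lemma sum_dyadic_blocks_le:
  fixes a b :: "nat ^ 'd \<Rightarrow> real" and \<beta> :: "'d \<Rightarrow> nat \<Rightarrow> real" and T :: "('d \<Rightarrow> nat) \<Rightarrow> nat ^ 'd"
  assumes \<beta>: "\<And>i. mono (\<beta> i)" "\<And>i k. \<beta> i k > 0"
    and b: "\<And>n. b n = (\<Prod>i\<in>UNIV. \<beta> i (n $ i))"
    and T: "\<And>m k. m \<le> T k \<longleftrightarrow> (\<forall>i. dyadic_level (\<beta> i) (m $ i) \<le> k i)"
    and a: "\<And>n. a n \<ge> 0" and r: "r > 0"
    and summable: "(\<lambda>n. a n / b n powr r) summable_on UNIV"
    and F: "finite F"
  shows "(\<Sum>k\<in>F. (2 ^ (\<Sum>i\<in>UNIV. k i)) powr (- r) * (\<Sum>m | m \<le> T k. a m))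
    \<le> (\<Prod>i\<in>UNIV. (2 * \<beta> i 0) powr r / (1 - 2 powr (- r))) * (\<Sum>\<^sub>\<infinity>n. a n / b n powr r)"
proof -
  define q :: real where "q = 2 powr (- r)"
  have q: "0 < q" "q < 1" using r by (auto simp: q_def powr_less_one)
  define D where "D = (\<Prod>i\<in>UNIV. (2 * \<beta> i 0) powr r / (1 - q))"
  have D: "0 \<le> D" unfolding D_def using q by (intro prod_nonneg) auto
  \<comment> \<open>The product of the \<open>h m i (k i)\<close> over \<open>i\<close> is the
    weight of block \<open>k\<close> if \<open>m \<le> T k\<close> and 0 otherwise, so the condition
    on \<open>k\<close> splits by coordinates.\<close>
  define h where "h m i j = (if dyadic_level (\<beta> i) (m $ i) \<le> j then q ^ j else 0)"
    for m :: "nat ^ 'd" and i j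
  \<comment> \<open>A finite range for \<open>m\<close> common to all \<open>k\<close> in
    \<open>F\<close> reduces the exchange of summations to finite sums.\<close>
  define G where "G = (\<Union>k\<in>F. {m. m \<le> T k})"
  have G: "finite G" unfolding G_def using F finite_atMost_vec by blast
  have b_pos: "b n > 0" for n unfolding b by (intro prod_pos) (simp add: \<beta>)
  have inner: "(\<Sum>k\<in>F. \<Prod>i\<in>UNIV. h m i (k i)) \<le> D * b m powr (- r)" for m
  proof -
    have "(\<Sum>k\<in>F. \<Prod>i\<in>UNIV. h m i (k i)) \<le> (\<Prod>i\<in>UNIV. q ^ dyadic_level (\<beta> i) (m $ i) / (1 - q))"
      using q F by (intro sum_prod_le_prod_bound) (auto simp: h_def intro!: geometric_tail_le)
    also have "\<dots> \<le> (\<Prod>i\<in>UNIV. (2 * \<beta> i 0) powr r / (1 - q) * \<beta> i (m $ i) powr (- r))"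
      using q dyadic_weight_le[OF \<beta>(1) \<beta>(2) r]
      by (intro prod_mono) (auto simp: q_def intro!: divide_right_mono)
    also have "\<dots> = D * b m powr (- r)"
      by (simp add: D_def b prod.distrib prod_dividef prod_powr_distrib less_imp_le[OF \<beta>(2)])
    finally show ?thesis .
  qed
  have outer: "(2 ^ (\<Sum>i\<in>UNIV. k i)) powr (- r) * (\<Sum>m | m \<le> T k. a m)
      = (\<Sum>m\<in>G. a m * (\<Prod>i\<in>UNIV. h m i (k i)))" if "k \<in> F" for k
  proof -
    have "(2 ^ (\<Sum>i\<in>UNIV. k i)) powr (- r) = q ^ (\<Sum>i\<in>UNIV. k i)"
      by (simp add: q_def powr_power powr_powr mult.commute del: of_nat_sum flip: powr_realpow)
    then have pow: "(2 ^ (\<Sum>i\<in>UNIV. k i)) powr (- r) = (\<Prod>i\<in>UNIV. q ^ k i)"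
      by (simp add: power_sum)
    have "(\<Sum>m\<in>G. a m * (\<Prod>i\<in>UNIV. h m i (k i))) = (\<Sum>m | m \<le> T k. a m * (\<Prod>i\<in>UNIV. q ^ k i))"
      using that G by (intro sum.mono_neutral_cong_right) (auto simp: G_def T h_def)
    then show ?thesis by (simp add: pow sum_distrib_left mult.commute)
  qed
  have "(\<Sum>k\<in>F. (2 ^ (\<Sum>i\<in>UNIV. k i)) powr (- r) * (\<Sum>m | m \<le> T k. a m))
      = (\<Sum>k\<in>F. \<Sum>m\<in>G. a m * (\<Prod>i\<in>UNIV. h m i (k i)))"
    by (intro sum.cong refl outer)
  also have "\<dots> = (\<Sum>m\<in>G. a m * (\<Sum>k\<in>F. \<Prod>i\<in>UNIV. h m i (k i)))"
    by (subst sum.swap) (simp add: sum_distrib_left)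
  also have "\<dots> \<le> (\<Sum>m\<in>G. a m * (D * b m powr (- r)))"
    by (intro sum_mono mult_left_mono inner a)
  also have "\<dots> = D * (\<Sum>m\<in>G. a m / b m powr r)"
    by (simp add: sum_distrib_left powr_minus field_simps)
  also have "\<dots> \<le> D * (\<Sum>\<^sub>\<infinity>n. a n / b n powr r)"
    using G a by (intro mult_left_mono D finite_sum_le_infsum summable) auto
  finally show ?thesis unfolding D_def q_def .
qed

theorem theorem4:
  fixes M :: "'w measure"
    and X :: "nat ^ 'd \<Rightarrow> 'w \<Rightarrow> real"
    and a b :: "nat ^ 'd \<Rightarrow> real"
    and r :: real
  assumes "prob_space M"
    and "\<And>n. X n \<in> borel_measurable M"
    and "\<And>n. a n \<ge> 0"
    and "r > 0"
    and "pos_nondecr_unbounded_product_type b"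
    and "(\<lambda>n. a n / b n powr r) summable_on UNIV"
    and "\<exists>C>0. \<forall>n. \<forall>\<epsilon>>0.
           measure M {\<omega> \<in> space M. Max ((\<lambda>m. \<bar>partial_sum X m \<omega>\<bar>) ` {m. m \<le> n}) \<ge> \<epsilon>}
             \<le> C * \<epsilon> powr (- r) * (\<Sum>m | m \<le> n. a m)"
  shows "AE \<omega> in M. ((\<lambda>n. partial_sum X n \<omega> / b n) \<longlongrightarrow> 0) at_top"
proof -
  interpret prob_space M by fact
  obtain \<beta> :: "'d \<Rightarrow> nat \<Rightarrow> real"
    where pos: "\<And>i k. \<beta> i k > 0" and mono: "\<And>i. mono (\<beta> i)"
      and unbdd: "\<And>i. \<not> bdd_above (range (\<beta> i))"
      and b: "\<And>n. b n = (\<Prod>i\<in>UNIV. \<beta> i (n $ i))"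
    using assms(5) unfolding pos_nondecr_unbounded_product_type_def by metis
  obtain C where C: "C > 0" and
    max_ineq: "\<And>n \<epsilon>. \<epsilon> > 0 \<Longrightarrow>
      prob {\<omega> \<in> space M. Max ((\<lambda>m. \<bar>partial_sum X m \<omega>\<bar>) ` {m. m \<le> n}) \<ge> \<epsilon>}
        \<le> C * \<epsilon> powr (- r) * (\<Sum>m | m \<le> n. a m)"
    using assms(7) by blast
  \<comment> \<open>Last corner of block \<open>k\<close>. Asking for level at most
    \<open>k i\<close>, not equal to it, gives a valid maximum even where \<open>\<beta> i\<close>
    jumps over a dyadic range.\<close>
  define T :: "('d \<Rightarrow> nat) \<Rightarrow> nat ^ 'd"
    where "T k = (\<chi> i. Max {m. dyadic_level (\<beta> i) m \<le> k i})" for k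
  have T: "m \<le> T k \<longleftrightarrow> (\<forall>i. dyadic_level (\<beta> i) (m $ i) \<le> k i)" for m k
    by (simp add: T_def less_eq_vec_def dyadic_level_le_iff[OF mono pos unbdd])
  have b_pos: "b n > 0" for n unfolding b by (intro prod_pos) (simp add: pos)
  have b_lower: "b 0 * 2 ^ (\<Sum>i\<in>UNIV. dyadic_level (\<beta> i) (n $ i)) \<le> b n" for n
  proof -
    have "(\<Prod>i\<in>UNIV. \<beta> i 0 * 2 ^ dyadic_level (\<beta> i) (n $ i)) \<le> (\<Prod>i\<in>UNIV. \<beta> i (n $ i))"
      by (intro prod_mono) (auto simp: dyadic_level_lower[OF mono pos] less_imp_le[OF pos])
    then show ?thesis by (simp add: b prod.distrib power_sum)
  qed
  have [measurable]: "partial_sum X n \<in> borel_measurable M" for n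
    unfolding partial_sum_def[abs_def] using assms(2) by measurable
  \<comment> \<open>By \<open>b_lower\<close> the threshold is at most
    \<open>\<epsilon> * b n\<close> for each \<open>n\<close> in block \<open>k\<close>; outside
    \<open>A \<epsilon> k\<close> the quotient is therefore below \<epsilon> on the whole
    block.\<close>
  define A where "A \<epsilon> k = {\<omega> \<in> space M. Max ((\<lambda>m. \<bar>partial_sum X m \<omega>\<bar>) ` {m. m \<le> T k})
      \<ge> \<epsilon> * b 0 * 2 ^ (\<Sum>i\<in>UNIV. k i)}" for \<epsilon> and k :: "'d \<Rightarrow> nat"
  have A_meas: "A \<epsilon> k \<in> events" for \<epsilon> k
    unfolding A_def by (intro Max_ge_event finite_atMost_vec) auto
  have fin: "AE \<omega> in M. finite {k. \<omega> \<in> A \<epsilon> k}" if \<epsilon>: "\<epsilon> > 0" for \<epsilon>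
  proof (rule borel_cantelli_countable[OF A_meas])
    fix F :: "('d \<Rightarrow> nat) set" assume F: "finite F"
    \<comment> \<open>The part of the threshold common to all blocks, raised to the power
      \<open>- r\<close>.\<close>
    let ?c = "C * (\<epsilon> * b 0) powr (- r)"
    have "prob (A \<epsilon> k) \<le> ?c * ((2 ^ (\<Sum>i\<in>UNIV. k i)) powr (- r) * (\<Sum>m | m \<le> T k. a m))" for k
      using max_ineq[of "\<epsilon> * b 0 * 2 ^ (\<Sum>i\<in>UNIV. k i)" "T k"] \<epsilon> b_pos[of 0]
      by (simp add: A_def powr_mult mult.assoc)
    then have "(\<Sum>k\<in>F. prob (A \<epsilon> k))
        \<le> ?c * (\<Sum>k\<in>F. (2 ^ (\<Sum>i\<in>UNIV. k i)) powr (- r) * (\<Sum>m | m \<le> T k. a m))"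
      unfolding sum_distrib_left by (rule sum_mono)
    also have "\<dots> \<le> ?c * ((\<Prod>i\<in>UNIV. (2 * \<beta> i 0) powr r / (1 - 2 powr (- r)))
        * (\<Sum>\<^sub>\<infinity>n. a n / b n powr r))"
      using C by (intro mult_left_mono sum_dyadic_blocks_le[OF mono pos b T] assms F) auto
    finally show "(\<Sum>k\<in>F. prob (A \<epsilon> k)) \<le> \<dots>" .
  qed
  \<comment> \<open>Restricting \<epsilon> to a sequence tending to 0 keeps the union of the
    exceptional null sets null.\<close>
  have "AE \<omega> in M. \<forall>p. finite {k. \<omega> \<in> A (inverse (real (Suc p))) k}"
    unfolding AE_all_countable by (intro allI fin) simp
  with AE_space show ?thesis
  proof eventually_elim
    case (elim \<omega>)
    show ?case
    proof (rule tendstoI)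
      fix e :: real assume "e > 0"
      then obtain p where p: "inverse (real (Suc p)) < e" using reals_Archimedean by blast
      let ?\<epsilon> = "inverse (real (Suc p))"
      \<comment> \<open>A common bound for all coordinates of the finitely many exceptional blocks.
        If there are none, the value of \<open>K\<close> is arbitrary and the next claim is
        vacuous.\<close>
      define K where "K = Max (\<Union>k\<in>{k. \<omega> \<in> A ?\<epsilon> k}. range k)"
      have K: "k i \<le> K" if "\<omega> \<in> A ?\<epsilon> k" for k i
        unfolding K_def using that elim(2) by (intro Max_ge) auto
      obtain N where N: "\<And>i n. N i \<le> n \<Longrightarrow> K < dyadic_level (\<beta> i) n"
        using dyadic_level_eventually_gt[OF mono pos unbdd] by metis
      have "\<bar>partial_sum X n \<omega>\<bar> < e * b n" if n: "\<And>i. Max (range N) \<le> n $ i" for n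
      proof -
        define k where "k i = dyadic_level (\<beta> i) (n $ i)" for i
        have "N i \<le> n $ i" for i
          using Max_ge[of "range N" "N i"] n[of i] by simp
        then have "K < k i" for i by (simp add: k_def N)
        \<comment> \<open>The index type is nonempty, so \<open>k\<close> has a coordinate above
          \<open>K\<close> and is not exceptional.\<close>
        then have "\<omega> \<notin> A ?\<epsilon> k" using K by (meson not_less)
        then have "Max ((\<lambda>m. \<bar>partial_sum X m \<omega>\<bar>) ` {m. m \<le> T k})
            < ?\<epsilon> * b 0 * 2 ^ (\<Sum>i\<in>UNIV. k i)"
          using elim(1) by (auto simp: A_def not_le)
        moreover have "n \<le> T k" by (simp add: T k_def)
        then have "\<bar>partial_sum X n \<omega>\<bar> \<le> Max ((\<lambda>m. \<bar>partial_sum X m \<omega>\<bar>) ` {m. m \<le> T k})"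
          by (intro Max_ge finite_imageI finite_atMost_vec) auto
        moreover have "?\<epsilon> * (b 0 * 2 ^ (\<Sum>i\<in>UNIV. k i)) \<le> ?\<epsilon> * b n"
          unfolding k_def by (intro mult_left_mono b_lower) simp
        moreover have "?\<epsilon> * b n < e * b n" using p b_pos by (intro mult_strict_right_mono)
        ultimately show ?thesis by (simp only: mult.assoc)
      qed
      then show "eventually (\<lambda>n. dist (partial_sum X n \<omega> / b n) 0 < e) at_top"
        unfolding eventually_at_top_vec using b_pos
        by (intro exI[of _ "Max (range N)"]) (auto simp: abs_divide divide_less_eq abs_of_pos)
    qed
  qed
qed

end
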